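(* Let $X$ be a nonempty set and $P$ a predicate on $X$. Then for every $f\in\mathcal P(X)^X$: $$(f\preccurlyeq\top_{\mathfrak{UM}(P)})\Rightarrow(\mathbf{Fix}(f)\subset P^{-1}(1)),\qquad (\bot_{\mathfrak{UM}(P)}\preccurlyeq f)\Rightarrow(P^{-1}(1)\subset\mathbf{Fix}(f)).$$ Consequently, $$\mathfrak{UM}(P)=\{f\in\mathcal P(X)^X\mid \bot_{\mathfrak{UM}(P)}\preccurlyeq f\preccurlyeq\top_{\mathfrak{UM}(P)}\},$$ and for every $f\in\mathcal P(X)^X$, $f\in\mathfrak{UM}(P)$ if and only if $f^{-1}\in\mathfrak{UM}(P)$.
   Context: $\mathcal P(X)$ is the power set of $X$; $\mathcal P(X)^X$ is the set of all multifunctions $f:X\to\mathcal P(X)$. A predicate on $X$ is a function $P:X\to\{0,1\}$; $P(x)$ is said to hold iff $P(x)=1$, and $P^{-1}(1)=\{x\in X\mid P(x)=1\}$. For a multifunction $f\in\mathcal P(X)^X$, $\mathbf{Fix}(f)=\{x\in X\mid x\in f(x)\}$, and $f^{-1}\in\mathcal P(X)^X$ is given by $f^{-1}(b)=\{a\in X\mid b\in f(a)\}$. The set of unlocking multifunctions of $P$ is $\mathfrak{UM}(P)=\{f\in\mathcal P(X)^X\mid \mathbf{Fix}(f)=P^{-1}(1)\}$. The partial order on $\mathcal P(X)^X$ is $g\preccurlyeq f$ iff $g(x)\subset f(x)$ for all $x\in X$. The multifunctions $\top_{\mathfrak{UM}(P)},\bot_{\mathfrak{UM}(P)}$ are the greatest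 and least elements of $(\mathfrak{UM}(P),\preccurlyeq)$, given explicitly by $\top_{\mathfrak{UM}(P)}(x)=X$ if $P(x)$ and $X\setminus\{x\}$ otherwise; $\bot_{\mathfrak{UM}(P)}(x)=\{x\}$ if $P(x)$ and $\varnothing$ otherwise. *)

theory Defs
  imports Main "HOL-Library.FuncSet"
begin

text \<open>
  The ground set is a carrier \<open>X\<close>.  Functions with domain \<open>X\<close> are represented by the
  extensional function space \<open>X \<rightarrow>\<^sub>E _\<close> (value \<open>undefined\<close> outside \<open>X\<close>), so that equality of
  functions on \<open>X\<close> is HOL equality.  A predicate \<open>X \<rightarrow> {0,1}\<close> is a boolean function, with
  \<open>True\<close> in the role of \<open>1\<close>; its values outside \<open>X\<close> are never used.
\<close>

definition multifunctions :: "'a set \<Rightarrow> ('a \<Rightarrow> 'a set) set" where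
  "multifunctions X = (X \<rightarrow>\<^sub>E Pow X)"

definition holds_set :: "'a set \<Rightarrow> ('a \<Rightarrow> bool) \<Rightarrow> 'a set" where
  "holds_set X P = {x \<in> X. P x}"

definition Fix :: "'a set \<Rightarrow> ('a \<Rightarrow> 'a set) \<Rightarrow> 'a set" where
  "Fix X f = {x \<in> X. x \<in> f x}"

definition inv_multi :: "'a set \<Rightarrow> ('a \<Rightarrow> 'a set) \<Rightarrow> ('a \<Rightarrow> 'a set)" where
  "inv_multi X f = (\<lambda>b\<in>X. {a \<in> X. b \<in> f a})"

definition UM :: "'a set \<Rightarrow> ('a \<Rightarrow> bool) \<Rightarrow> ('a \<Rightarrow> 'a set) set" where
  "UM X P = {f \<in> multifunctions X. Fix X f = holds_set X P}"

definition multi_le :: "'a set \<Rightarrow> ('a \<Rightarrow> 'a set) \<Rightarrow> ('a \<Rightarrow> 'a set) \<Rightarrow> bool" where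
  "multi_le X g f \<longleftrightarrow> (\<forall>x\<in>X. g x \<subseteq> f x)"

definition top_UM :: "'a set \<Rightarrow> ('a \<Rightarrow> bool) \<Rightarrow> ('a \<Rightarrow> 'a set)" where
  "top_UM X P = (\<lambda>x\<in>X. if P x then X else X - {x})"

definition bot_UM :: "'a set \<Rightarrow> ('a \<Rightarrow> bool) \<Rightarrow> ('a \<Rightarrow> 'a set)" where
  "bot_UM X P = (\<lambda>x\<in>X. if P x then {x} else {})"

text \<open>The two explicit formulas do define the greatest and the least unlocking multifunction.\<close>

lemma top_UM_greatest:
  "top_UM X P \<in> UM X P" "f \<in> UM X P \<Longrightarrow> multi_le X f (top_UM X P)"
  by (auto simp: UM_def multifunctions_def Fix_def holds_set_def top_UM_def multi_le_def
      split: if_splits)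

lemma bot_UM_least:
  "bot_UM X P \<in> UM X P" "f \<in> UM X P \<Longrightarrow> multi_le X (bot_UM X P) f"
  by (auto simp: UM_def multifunctions_def Fix_def holds_set_def bot_UM_def multi_le_def
      split: if_splits)

end

theory Submission imports Defs begin

text \<open>
  Whether \<open>f\<close> unlocks \<open>P\<close> depends only on the diagonal of \<open>f\<close>, that is, on the truth values of
  \<open>x \<in> f x\<close>.  The greatest unlocking multifunction constrains a multifunction below it only at
  the diagonal points where \<open>P\<close> fails, and the least one constrains a multifunction above it only
  at the diagonal points where \<open>P\<close> holds.  So each of the two order relations amounts to one of
  the two inclusions between the fixed points and the points satisfying \<open>P\<close>
  (\<open>multi_le_top_UM_iff\<close>, \<open>multi_le_bot_UM_iff\<close>), and both together amount to equality.
  Inversion transposes the graph of \<open>f\<close>, which leaves the diagonal in place (\<open>Fix_inv_multi\<close>).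
\<close>

text \<open>
  Since \<open>f x \<subseteq> X\<close>, the inclusion in \<open>top_UM X P x\<close> is automatic when \<open>P x\<close> holds, and
  otherwise it forbids exactly the value \<open>x\<close>.
\<close>

lemma multi_le_top_UM_iff:
  assumes "f \<in> multifunctions X"
  shows "multi_le X f (top_UM X P) \<longleftrightarrow> Fix X f \<subseteq> holds_set X P"
proof -
  have sub_X: "f x \<subseteq> X" if "x \<in> X" for x
    using assms that by (auto simp: multifunctions_def)
  have "f x \<subseteq> top_UM X P x \<longleftrightarrow> (x \<in> f x \<longrightarrow> P x)" if "x \<in> X" for x
    using sub_X[OF that] that by (auto simp: top_UM_def)
  then show ?thesis
    by (auto simp: multi_le_def Fix_def holds_set_def)
qed

text \<open>
  Being above \<open>{}\<close> is no condition, and being above \<open>{x}\<close> says that \<open>x\<close> is a fixed point.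
\<close>

lemma multi_le_bot_UM_iff:
  "multi_le X (bot_UM X P) f \<longleftrightarrow> holds_set X P \<subseteq> Fix X f"
  by (auto simp: multi_le_def bot_UM_def Fix_def holds_set_def)

lemma inv_multi_in_multifunctions: "inv_multi X f \<in> multifunctions X"
  by (auto simp: inv_multi_def multifunctions_def)

lemma Fix_inv_multi: "Fix X (inv_multi X f) = Fix X f"
  by (auto simp: Fix_def inv_multi_def)

theorem lemma3p1:
  fixes X :: "'a set" and P :: "'a \<Rightarrow> bool"
  assumes "X \<noteq> {}"
  shows "(\<forall>f \<in> multifunctions X.
            (multi_le X f (top_UM X P) \<longrightarrow> Fix X f \<subseteq> holds_set X P) \<and>
            (multi_le X (bot_UM X P) f \<longrightarrow> holds_set X P \<subseteq> Fix X f)) \<and>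
         UM X P = {f \<in> multifunctions X.
            multi_le X (bot_UM X P) f \<and> multi_le X f (top_UM X P)} \<and>
         (\<forall>f \<in> multifunctions X. f \<in> UM X P \<longleftrightarrow> inv_multi X f \<in> UM X P)"
proof (intro conjI)
  show "\<forall>f \<in> multifunctions X.
          (multi_le X f (top_UM X P) \<longrightarrow> Fix X f \<subseteq> holds_set X P) \<and>
          (multi_le X (bot_UM X P) f \<longrightarrow> holds_set X P \<subseteq> Fix X f)"
    by (simp add: multi_le_top_UM_iff multi_le_bot_UM_iff)
  show "UM X P = {f \<in> multifunctions X.
          multi_le X (bot_UM X P) f \<and> multi_le X f (top_UM X P)}"
    by (auto simp: UM_def multi_le_top_UM_iff multi_le_bot_UM_iff)
  show "\<forall>f \<in> multifunctions X. f \<in> UM X P \<longleftrightarrow> inv_multi X f \<in> UM X P"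
    by (simp add: UM_def inv_multi_in_multifunctions Fix_inv_multi)
qed

end
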